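(* Let $a, b \in \mathbb{N}$ with $a+b > 2$, and let $x \in \mathbb{R}$ with $x > 2$. Then $$P_a(x)\, P_b(x) > P_{a+b}(x).$$ Moreover, for $x = 2$ the same inequality $P_a(2)\, P_b(2) > P_{a+b}(2)$ holds for all $a, b \in \mathbb{N}$ with $a+b > 4$.
   Context: $\mathbb{N} = \{1,2,3,\ldots\}$. For $n \in \mathbb{N}$ let $\sigma(n) := \sum_{d \mid n} d$ be the sum of the positive divisors of $n$. The polynomials $P_n(x)$ are defined recursively by $P_0(x) := 1$ and, for $n \geq 1$, $P_n(x) := \frac{x}{n} \sum_{k=1}^{n} \sigma(k)\, P_{n-k}(x)$. Equivalently, $\sum_{n=0}^{\infty} P_n(z)\, q^n = \prod_{n=1}^{\infty} (1-q^n)^{-z}$ for $z \in \mathbb{C}$; in particular, for $k \in \mathbb{N}$, $P_n(k)$ is the number of $k$-colored partitions of $n$. *)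

theory Defs
  imports Complex_Main "HOL-Computational_Algebra.Polynomial"
begin

definition divisor_sum :: "nat \<Rightarrow> nat" where
  "divisor_sum n = (\<Sum>d | d dvd n. d)"

function P_poly :: "nat \<Rightarrow> real poly" where
  "P_poly 0 = 1"
| "P_poly (Suc n) = smult (1 / real (Suc n))
     ([:0, 1:] * (\<Sum>k=1..Suc n. smult (real (divisor_sum k)) (P_poly (Suc n - k))))"
  by pat_completeness auto
termination by (relation "measure id") auto

lemma poly_P_poly_rec:
  assumes "n \<ge> 1"
  shows "poly (P_poly n) x = x / real n * (\<Sum>k=1..n. real (divisor_sum k) * poly (P_poly (n - k)) x)"
  using assms by (cases n) (simp_all add: poly_sum del: sum.cl_ivl_Suc)

end

theory Submission
  imports Defs
begin

text \<open>
  Fix \<open>x \<ge> 2\<close> and let \<open>D(a, b) = P\<^sub>a(x) P\<^sub>b(x) - P\<^sub>a\<^sub>+\<^sub>b(x)\<close>. Applying the recursion to each of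
  \<open>a P\<^sub>a\<close>, \<open>b P\<^sub>b\<close> and \<open>(a + b) P\<^sub>a\<^sub>+\<^sub>b\<close> gives the identity
  \[ (a + b) D(a, b) = x \sum_{k=1}^{a} \sigma(k) D(a - k, b)
       + x \sum_{k=1}^{b} (\sigma(k) P_a - \sigma(a + k)) P_{b - k}, \]
  proved as \<open>defect_rec\<close>. By symmetry one may take \<open>a \<ge> b\<close>. The first sum is then controlled by
  induction, and in the second one every summand is positive as soon as
  \<open>\<sigma>(a + k) < \<sigma>(k) P\<^sub>a\<close> for \<open>1 \<le> k \<le> b\<close>. Since \<open>a + k \<le> 2 a\<close>, quadratic bounds suffice for that:
  \<open>\<sigma>(m) \<le> (m\<^sup>2 - m + 2) / 2\<close> for \<open>m \<ge> 3\<close> (\<open>divisor_sum_le\<close>) and \<open>P\<^sub>a \<ge> a\<^sup>2 + 1\<close>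
  (\<open>P_poly_ge_square\<close>).

  The one obstacle is that \<open>D(1, 1) = x (x - 3) / 2\<close> is negative for \<open>x < 3\<close>. In the identity this
  defect occurs only when \<open>b = 1\<close>, with weight \<open>\<sigma>(a - 1)\<close>, and there \<open>D(1, 1) \<ge> -1\<close>; so the family
  \<open>D(a, 1)\<close> is settled first, by the stronger estimate \<open>\<sigma>(a + 1) + \<sigma>(a - 1) < P\<^sub>a\<close>, which holds
  from \<open>a = 4\<close> on. The cases \<open>a = 2\<close> and \<open>a = 3\<close> are the ones in which equality occurs at \<open>x = 2\<close>.
\<close>

section \<open>Bounds for divisor sums\<close>

lemma divisor_sum_ge: "n \<le> divisor_sum n"
proof (cases "n = 0")
  case False
  have "(\<Sum>d\<in>{n}. d) \<le> (\<Sum>d | d dvd n. d)"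
    using False by (intro sum_mono2) auto
  then show ?thesis by (simp add: divisor_sum_def)
qed simp

text \<open>
  For \<open>m \<ge> 3\<close> the number \<open>m - 1\<close> does not divide \<open>m\<close>, so it can be dropped from
  \<open>1 + 2 + \<dots> + m = m (m + 1) / 2\<close>. With the trivial bound the comparison of \<open>\<sigma>(3)\<close> with
  \<open>P\<^sub>2(2) = 5\<close> would already fail.
\<close>

lemma divisor_sum_le:
  assumes "m \<ge> 3"
  shows "2 * divisor_sum m \<le> m * (m - 1) + 2"
proof -
  obtain n where m: "m = Suc (Suc n)" and n: "n \<ge> 1"
    using assms by (intro that[of "m - 2"]) auto
  have "\<not> Suc n dvd Suc (Suc n)"
  proof
    assume "Suc n dvd Suc (Suc n)"
    then have "Suc n dvd Suc (Suc n) - Suc n" by (rule dvd_diff_nat) simp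
    with n show False by simp
  qed
  moreover have "d \<le> m" if "d dvd m" for d
    using dvd_imp_le[OF that] m by simp
  ultimately have "{d. d dvd m} \<subseteq> insert m {..n}"
    unfolding m by (auto simp: le_Suc_eq)
  then have "divisor_sum m \<le> \<Sum>(insert m {..n})"
    unfolding divisor_sum_def by (intro sum_mono2) auto
  also have "\<dots> = m + \<Sum>{..n}" using m by simp
  finally have "2 * divisor_sum m \<le> 2 * m + 2 * \<Sum>{..n}" by simp
  also have "2 * \<Sum>{..n} = n * (n + 1)"
    using gauss_sum_nat[of n] by (simp add: atMost_atLeast0)
  finally show ?thesis unfolding m by simp
qed

lemma divisor_sum_le_real:
  assumes "m \<ge> 3"
  shows "real (divisor_sum m) \<le> (real m ^ 2 - real m + 2) / 2"
proof -
  have "real (2 * divisor_sum m) \<le> real (m * (m - 1) + 2)"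
    using divisor_sum_le[OF assms] by (simp only: of_nat_le_iff)
  moreover have "real (m - 1) = real m - 1" using assms by simp
  ultimately show ?thesis by (simp add: algebra_simps power2_eq_square)
qed

lemma sum_upto_small:
  fixes f :: "nat \<Rightarrow> 'a::comm_monoid_add"
  shows "(\<Sum>k=1..1. f k) = f 1" "(\<Sum>k=1..2. f k) = f 1 + f 2"
    "(\<Sum>k=1..3. f k) = f 1 + f 2 + f 3" "(\<Sum>k=1..4. f k) = f 1 + f 2 + f 3 + f 4"
  by (simp_all add: numeral_eq_Suc)

lemma divisor_sum_small:
  "divisor_sum 1 = 1" "divisor_sum 2 = 3" "divisor_sum 3 = 4" "divisor_sum 4 = 7"
proof -
  have eq: "divisor_sum n = (\<Sum>d=1..n. if d dvd n then d else 0)" if "n > 0" for n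
  proof -
    have "{d. d dvd n} = {d \<in> {1..n}. d dvd n}"
      using that dvd_imp_le[of _ n] by (auto intro!: Suc_leI Nat.gr0I)
    then show ?thesis
      unfolding divisor_sum_def by (simp only: sum.inter_filter finite_atLeastAtMost)
  qed
  show "divisor_sum 1 = 1" "divisor_sum 2 = 3" "divisor_sum 3 = 4" "divisor_sum 4 = 7"
    by (simp_all only: eq sum_upto_small zero_less_numeral zero_less_one) simp_all
qed

section \<open>A quadratic lower bound for the polynomials\<close>

(* The recursion is used only after evaluation, in the form cleared of its denominator. *)
declare P_poly.simps(2) [simp del]

abbreviation pv :: "real \<Rightarrow> nat \<Rightarrow> real" where
  "pv x n \<equiv> poly (P_poly n) x"

lemma P_poly_rec_mult:
  "real n * pv x n = x * (\<Sum>k=1..n. real (divisor_sum k) * pv x (n - k))"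
  by (cases "n = 0") (simp_all add: poly_P_poly_rec)

lemma P_poly_small:
  "pv x 0 = 1" "pv x 1 = x" "pv x 2 = x * (x + 3) / 2"
  "pv x 3 = x * (x + 1) * (x + 8) / 6"
  "pv x 4 = x * (pv x 3 + 3 * pv x 2 + 4 * x + 7) / 4"
proof -
  show p0: "pv x 0 = 1" by simp
  show p1: "pv x 1 = x"
    using P_poly_rec_mult[of 1 x] unfolding sum_upto_small by (simp add: divisor_sum_small(1)[unfolded One_nat_def])
  show p2: "pv x 2 = x * (x + 3) / 2"
    using P_poly_rec_mult[of 2 x] p1 unfolding sum_upto_small
    by (simp add: divisor_sum_small(2-) divisor_sum_small(1)[unfolded One_nat_def])
  show p3: "pv x 3 = x * (x + 1) * (x + 8) / 6"
    using P_poly_rec_mult[of 3 x] p1 p2 unfolding sum_upto_small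
    by (simp add: divisor_sum_small(2-) divisor_sum_small(1)[unfolded One_nat_def] field_simps)
  show "pv x 4 = x * (pv x 3 + 3 * pv x 2 + 4 * x + 7) / 4"
    using P_poly_rec_mult[of 4 x] p1 unfolding sum_upto_small
    by (simp add: divisor_sum_small(2-) divisor_sum_small(1)[unfolded One_nat_def])
qed

lemma sum_weighted_squares:
  "(\<Sum>k=1..n. real k * (real (n - k) ^ 2 + 1)) = real n ^ 2 * (real n ^ 2 - 1) / 12 + real n * (real n + 1) / 2"
proof -
  \<comment> \<open>The upper index is decoupled from the parameter \<open>n\<close> so that the sum telescopes.\<close>
  have "(\<Sum>k=1..m. real k * ((y - real k) ^ 2 + 1)) =
      (y ^ 2 + 1) * (real m * (real m + 1) / 2) - 2 * y * (real m * (real m + 1) * (2 * real m + 1) / 6)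
      + (real m * (real m + 1) / 2) ^ 2" for m and y :: real
    by (induction m) (simp_all add: field_simps power2_eq_square)
  from this[of "real n" n]
  have "(\<Sum>k=1..n. real k * ((real n - real k) ^ 2 + 1)) =
      real n ^ 2 * (real n ^ 2 - 1) / 12 + real n * (real n + 1) / 2"
    by (simp add: field_simps power2_eq_square)
  moreover have "(\<Sum>k=1..n. real k * (real (n - k) ^ 2 + 1)) =
      (\<Sum>k=1..n. real k * ((real n - real k) ^ 2 + 1))"
    by (intro sum.cong) (auto simp: of_nat_diff)
  ultimately show ?thesis by simp
qed

text \<open>
  Feeding \<open>\<sigma>(k) \<ge> k\<close> and the bound itself into the recursion yields a cubic in \<open>n\<close>, namely
  \<open>n (n\<^sup>2 - 1) / 6 + n + 1\<close>. It dominates \<open>n\<^sup>2 + 1\<close> from \<open>n = 5\<close> on but falls short of it for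
  \<open>n = 2, 3, 4\<close>, so small \<open>n\<close> are read off from the explicit polynomials. At \<open>x = 2\<close> the bound is an
  equality for \<open>n \<le> 3\<close>.
\<close>

lemma P_poly_ge_square:
  assumes x: "x \<ge> 2"
  shows "real n ^ 2 + 1 \<le> pv x n"
proof (induction n rule: less_induct)
  case (less n)
  have two: "x * (x + 3) / 2 \<ge> 5"
    using mult_mono[of 2 x 5 "x + 3"] x by simp
  have three: "x * (x + 1) * (x + 8) / 6 \<ge> 10"
    using mult_mono[of 6 "x * (x + 1)" 10 "x + 8"] mult_mono[of 2 x 3 "x + 1"] x by simp
  have four: "x * (x * (x + 1) * (x + 8) / 6 + 3 * (x * (x + 3) / 2) + 4 * x + 7) / 4 \<ge> 20"
    using mult_mono[of 2 x 40 "x * (x + 1) * (x + 8) / 6 + 3 * (x * (x + 3) / 2) + 4 * x + 7"]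
      two three x by simp
  consider "n = 0" | "n = 1" | "n = 2" | "n = 3" | "n = 4" | "n \<ge> 5" by linarith
  then show ?case
  proof cases
    case 6
    have "real k * (real (n - k) ^ 2 + 1) \<le> real (divisor_sum k) * pv x (n - k)"
      if "k \<in> {1..n}" for k
      using that divisor_sum_ge[of k] less.IH[of "n - k"] by (intro mult_mono) auto
    then have sum_le: "(\<Sum>k=1..n. real k * (real (n - k) ^ 2 + 1))
        \<le> (\<Sum>k=1..n. real (divisor_sum k) * pv x (n - k))"
      by (intro sum_mono)
    have "real n * (real n ^ 2 + 1) \<le>
        2 * (real n ^ 2 * (real n ^ 2 - 1) / 12 + real n * (real n + 1) / 2)"
    proof -
      have "0 \<le> real n ^ 2 * ((real n - 1) * (real n - 5))"
        using 6 by (intro mult_nonneg_nonneg) auto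
      then show ?thesis by (simp add: field_simps power2_eq_square)
    qed
    also have "\<dots> = 2 * (\<Sum>k=1..n. real k * (real (n - k) ^ 2 + 1))"
      by (simp only: sum_weighted_squares)
    also have "\<dots> \<le> x * (\<Sum>k=1..n. real (divisor_sum k) * pv x (n - k))"
      using x sum_le by (intro mult_mono) (auto intro: sum_nonneg)
    also have "\<dots> = real n * pv x n" by (simp only: P_poly_rec_mult)
    finally show ?thesis using 6 by simp
  qed (use x two three four in \<open>simp_all add: P_poly_small P_poly_small(2)[unfolded One_nat_def]\<close>)
qed

lemma P_poly_pos: "x \<ge> 2 \<Longrightarrow> pv x n > 0"
  using P_poly_ge_square[of x n] by (smt (verit) zero_le_power2)

section \<open>The defect of multiplicativity and its recursion\<close>

definition defect :: "real \<Rightarrow> nat \<Rightarrow> nat \<Rightarrow> real" where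
  "defect x a b = pv x a * pv x b - pv x (a + b)"

lemma defect_commute: "defect x a b = defect x b a"
  by (simp add: defect_def add.commute)

lemma defect_0_left [simp]: "defect x 0 b = 0"
  by (simp add: defect_def)

text \<open>
  The sum for \<open>(a + b) P\<^sub>a\<^sub>+\<^sub>b\<close> is cut at \<open>k = a\<close>: its first part pairs with \<open>(a P\<^sub>a) P\<^sub>b\<close> and its
  second part, after the shift \<open>k \<mapsto> a + k\<close>, with \<open>P\<^sub>a (b P\<^sub>b)\<close>.
\<close>

lemma defect_rec:
  "real (a + b) * defect x a b =
     x * (\<Sum>k=1..a. real (divisor_sum k) * defect x (a - k) b) +
     x * (\<Sum>k=1..b. (real (divisor_sum k) * pv x a - real (divisor_sum (a + k))) * pv x (b - k))"
proof -
  let ?s = "\<lambda>k. real (divisor_sum k)"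
  have "(\<Sum>k=1..a + b. ?s k * pv x (a + b - k)) =
      (\<Sum>k=1..a. ?s k * pv x (a + b - k)) + (\<Sum>k=a + 1..a + b. ?s k * pv x (a + b - k))"
    by (rule sum.ub_add_nat) simp
  also have "(\<Sum>k=a + 1..a + b. ?s k * pv x (a + b - k)) = (\<Sum>k=1..b. ?s (a + k) * pv x (b - k))"
    using sum.shift_bounds_cl_nat_ivl[of "\<lambda>k. ?s k * pv x (a + b - k)" 1 a b]
    by (simp add: add.commute)
  also have "(\<Sum>k=1..a. ?s k * pv x (a + b - k)) = (\<Sum>k=1..a. ?s k * pv x (a - k + b))"
    by (intro sum.cong) auto
  finally have split: "real (a + b) * pv x (a + b) =
      x * ((\<Sum>k=1..a. ?s k * pv x (a - k + b)) + (\<Sum>k=1..b. ?s (a + k) * pv x (b - k)))"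
    by (simp only: P_poly_rec_mult)
  have "real (a + b) * defect x a b =
      (real a * pv x a) * pv x b + (real b * pv x b) * pv x a - real (a + b) * pv x (a + b)"
    by (simp add: defect_def algebra_simps)
  also have "\<dots> = x * (\<Sum>k=1..a. ?s k * pv x (a - k)) * pv x b +
      x * (\<Sum>k=1..b. ?s k * pv x (b - k)) * pv x a -
      x * ((\<Sum>k=1..a. ?s k * pv x (a - k + b)) + (\<Sum>k=1..b. ?s (a + k) * pv x (b - k)))"
    by (simp only: P_poly_rec_mult[of a] P_poly_rec_mult[of b] split)
  also have "\<dots> = x * ((\<Sum>k=1..a. ?s k * pv x (a - k)) * pv x b - (\<Sum>k=1..a. ?s k * pv x (a - k + b))) +
      x * ((\<Sum>k=1..b. ?s k * pv x (b - k)) * pv x a - (\<Sum>k=1..b. ?s (a + k) * pv x (b - k)))"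
    by (simp add: algebra_simps)
  also have "(\<Sum>k=1..a. ?s k * pv x (a - k)) * pv x b - (\<Sum>k=1..a. ?s k * pv x (a - k + b)) =
      (\<Sum>k=1..a. ?s k * defect x (a - k) b)"
    by (simp add: defect_def sum_distrib_right flip: sum_subtractf) (simp add: algebra_simps)
  also have "(\<Sum>k=1..b. ?s k * pv x (b - k)) * pv x a - (\<Sum>k=1..b. ?s (a + k) * pv x (b - k)) =
      (\<Sum>k=1..b. (?s k * pv x a - ?s (a + k)) * pv x (b - k))"
    by (simp add: sum_distrib_right flip: sum_subtractf) (simp add: algebra_simps)
  finally show ?thesis .
qed

section \<open>One part equal to one\<close>

lemma defect_1_1: "defect x 1 1 = x * (x - 3) / 2"
  by (simp add: defect_def P_poly_small P_poly_small(2)[unfolded One_nat_def] one_add_one[unfolded One_nat_def]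
      field_simps numeral_2_eq_2[symmetric])

lemma defect_1_1_ge:
  assumes "x \<ge> 2"
  shows "defect x 1 1 \<ge> -1"
proof -
  have "0 \<le> (x - 1) * (x - 2)" using assms by (intro mult_nonneg_nonneg) auto
  then show ?thesis unfolding defect_1_1 by (simp add: field_simps)
qed

lemma defect_2_1: "defect x 2 1 = x * (x ^ 2 - 4) / 3"
proof -
  have "defect x 2 1 = pv x 2 * pv x 1 - pv x 3" by (simp only: defect_def) simp
  then show ?thesis
    by (simp only: P_poly_small) (simp add: field_simps power2_eq_square)
qed

lemma defect_3_1:
  "4 * defect x 3 1 = x * (defect x 2 1 + 3 * defect x 1 1 + pv x 3 - 7)"
proof -
  show ?thesis
    using defect_rec[of 3 1 x] unfolding sum_upto_small
    by (simp add: divisor_sum_small(2-) divisor_sum_small(1)[unfolded One_nat_def] algebra_simps)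
qed

text \<open>
  The summand \<open>k = a - 1\<close> of the recursion contains \<open>D(1, 1)\<close>, the only possibly negative defect;
  bounding it below by \<open>-1\<close> costs \<open>\<sigma>(a - 1)\<close>.
\<close>

lemma defect_1_right_pos_step:
  assumes x: "x \<ge> 2" and a: "a \<ge> 4"
    and IH: "\<And>c. 2 \<le> c \<Longrightarrow> c < a \<Longrightarrow> defect x c 1 \<ge> 0"
  shows "defect x a 1 > 0"
proof -
  let ?s = "\<lambda>k. real (divisor_sum k)"
  have "- ?s (a - 1) = (\<Sum>k=1..a. if k = a - 1 then - ?s (a - 1) else 0)"
    using a by simp
  also have "\<dots> \<le> (\<Sum>k=1..a. ?s k * defect x (a - k) 1)"
  proof (rule sum_mono)
    fix k assume k: "k \<in> {1..a}"
    consider "k = a - 1" | "k = a" | "2 \<le> a - k" "a - k < a"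
      using k by fastforce
    then show "(if k = a - 1 then - ?s (a - 1) else 0) \<le> ?s k * defect x (a - k) 1"
    proof cases
      case 1
      then have "a - k = 1" using a by simp
      then show ?thesis
        using 1 mult_left_mono[OF defect_1_1_ge[OF x], of "?s k"] by (simp)
    next
      case 2
      then show ?thesis using a by simp
    next
      case 3
      then show ?thesis using IH[of "a - k"] by (auto intro!: mult_nonneg_nonneg)
    qed
  qed
  finally have first: "- ?s (a - 1) \<le> (\<Sum>k=1..a. ?s k * defect x (a - k) 1)" .
  have "?s (a + 1) \<le> (real (a + 1) ^ 2 - real (a + 1) + 2) / 2"
    using a by (intro divisor_sum_le_real) simp
  moreover have "?s (a - 1) \<le> (real (a - 1) ^ 2 - real (a - 1) + 2) / 2"
    using a by (intro divisor_sum_le_real) simp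
  moreover have "real (a - 1) = real a - 1" using a by simp
  ultimately have "?s (a + 1) + ?s (a - 1) \<le> real a ^ 2 - real a + 3"
    by (simp add: power2_eq_square field_simps)
  also have "\<dots> < real a ^ 2 + 1" using a by simp
  also have "\<dots> \<le> pv x a" by (rule P_poly_ge_square[OF x])
  finally have second: "?s (a + 1) + ?s (a - 1) < pv x a" .
  have "real (a + 1) * defect x a 1 =
      x * ((\<Sum>k=1..a. ?s k * defect x (a - k) 1) + (pv x a - ?s (a + 1)))"
    using defect_rec[of a 1 x]
    by (simp add: divisor_sum_small(1)[unfolded One_nat_def] algebra_simps)
  also have "\<dots> > 0" using x first second by (intro mult_pos_pos) auto
  finally show ?thesis by (simp add: zero_less_mult_iff)
qed

lemma defect_1_right:
  assumes x: "x \<ge> 2" and a: "a \<ge> 2"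
  shows "defect x a 1 \<ge> 0 \<and> (x > 2 \<or> a \<ge> 4 \<longrightarrow> defect x a 1 > 0)"
  using a
proof (induction a rule: less_induct)
  case (less a)
  have two: "defect x 2 1 \<ge> 0 \<and> (x > 2 \<longrightarrow> defect x 2 1 > 0)"
  proof -
    have "x ^ 2 - 4 = (x - 2) * (x + 2)" by (simp add: power2_eq_square algebra_simps)
    then show ?thesis unfolding defect_2_1 using x by simp
  qed
  consider "a = 2" | "a = 3" | "a \<ge> 4" using less.prems by linarith
  then show ?case
  proof cases
    case 1
    with two show ?thesis by auto
  next
    case 2
    have "pv x 3 \<ge> 10" using P_poly_ge_square[OF x, of 3] by simp
    \<comment> \<open>The estimates \<open>0\<close>, \<open>-1\<close> and \<open>10\<close> add up to exactly \<open>0\<close>; strictness comes from \<open>D(2, 1)\<close>.\<close>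
    with two defect_1_1_ge[OF x]
    have "defect x 2 1 + 3 * defect x 1 1 + pv x 3 - 7 \<ge> 0 \<and>
        (x > 2 \<longrightarrow> defect x 2 1 + 3 * defect x 1 1 + pv x 3 - 7 > 0)"
      by linarith
    then have "4 * defect x 3 1 \<ge> 0 \<and> (x > 2 \<longrightarrow> 4 * defect x 3 1 > 0)"
      unfolding defect_3_1 using x by (auto intro: mult_nonneg_nonneg mult_pos_pos)
    with 2 show ?thesis by auto
  next
    case 3
    then have "defect x a 1 > 0"
      using less.IH by (intro defect_1_right_pos_step[OF x]) auto
    then show ?thesis by simp
  qed
qed

section \<open>Both parts at least two\<close>

text \<open>
  With \<open>\<sigma>(k) \<ge> k\<close> and \<open>P\<^sub>a \<ge> a\<^sup>2 + 1 \<ge> (a\<^sup>2 + 3 a) / 2\<close>, the claim reduces to the positivity of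
  \<open>(k - 1) a\<^sup>2 + k (a - k) + (a - 2) + k\<close>.
\<close>

lemma divisor_sum_add_less:
  assumes x: "x \<ge> 2" and a: "a \<ge> 2" and k: "1 \<le> k" "k \<le> a"
  shows "real (divisor_sum (a + k)) < real (divisor_sum k) * pv x a"
proof -
  define A K where "A = real a" and "K = real k"
  have AK: "A \<ge> 2" "1 \<le> K" "K \<le> A" using a k by (auto simp: A_def K_def)
  have "real (divisor_sum (a + k)) \<le> ((A + K) ^ 2 - (A + K) + 2) / 2"
    using divisor_sum_le_real[of "a + k"] a k by (simp add: A_def K_def)
  also have "\<dots> < K * ((A ^ 2 + 3 * A) / 2)"
  proof -
    have "0 \<le> (K - 1) * A ^ 2" "0 \<le> K * (A - K)" using AK by auto
    then have "0 < (K - 1) * A ^ 2 + K * (A - K) + (A - 2) + K" using AK by linarith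
    then show ?thesis by (simp add: field_simps power2_eq_square)
  qed
  also have "\<dots> \<le> K * (A ^ 2 + 1)"
  proof -
    have "0 \<le> (A - 1) * (A - 2)" using AK by (intro mult_nonneg_nonneg) auto
    then have "(A ^ 2 + 3 * A) / 2 \<le> A ^ 2 + 1" by (simp add: field_simps power2_eq_square)
    then show ?thesis using AK by (intro mult_left_mono) auto
  qed
  also have "\<dots> \<le> real (divisor_sum k) * pv x a"
    using divisor_sum_ge[of k] P_poly_ge_square[OF x, of a]
    by (intro mult_mono) (auto simp: A_def K_def)
  finally show ?thesis .
qed

lemma defect_pos:
  assumes x: "x \<ge> 2" and "a \<ge> 2" "b \<ge> 2"
  shows "defect x a b > 0"
  using assms(2,3)
proof (induction "a + b" arbitrary: a b rule: less_induct)
  case less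
  \<comment> \<open>The recursion is unrolled in the larger index, so that \<open>k \<le> b \<le> a\<close> in its second sum.\<close>
  have main: "defect x a b > 0"
    if ab: "2 \<le> b" "b \<le> a" and IH: "\<And>c. 2 \<le> c \<Longrightarrow> c < a \<Longrightarrow> defect x c b > 0" for a b
  proof -
    let ?s = "\<lambda>k. real (divisor_sum k)"
    have "defect x c b \<ge> 0" if "c < a" for c
    proof -
      consider "c = 0" | "c = 1" | "c \<ge> 2" by linarith
      then show ?thesis
      proof cases
        case 2
        then show ?thesis using defect_1_right[OF x ab(1)] by (simp add: defect_commute)
      qed (use IH[of c] that in \<open>simp_all add: less_imp_le\<close>)
    qed
    then have first: "0 \<le> (\<Sum>k=1..a. ?s k * defect x (a - k) b)"
      by (intro sum_nonneg mult_nonneg_nonneg) auto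
    have second: "0 < (\<Sum>k=1..b. (?s k * pv x a - ?s (a + k)) * pv x (b - k))"
      using ab divisor_sum_add_less[OF x, of a] P_poly_pos[OF x]
      by (intro sum_pos mult_pos_pos) auto
    have "0 < x * (\<Sum>k=1..a. ?s k * defect x (a - k) b) +
        x * (\<Sum>k=1..b. (?s k * pv x a - ?s (a + k)) * pv x (b - k))"
      using x first second by (intro add_nonneg_pos mult_nonneg_nonneg mult_pos_pos) auto
    also have "\<dots> = real (a + b) * defect x a b" by (simp only: defect_rec)
    finally show ?thesis by (simp add: zero_less_mult_iff)
  qed
  show ?case
  proof (cases "b \<le> a")
    case True
    then show ?thesis using less.prems by - (rule main, auto intro: less.hyps)
  next
    case False
    then have "defect x b a > 0"
      using less.prems by - (rule main, auto intro: less.hyps)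
    then show ?thesis by (simp add: defect_commute)
  qed
qed

lemma defect_pos_cases:
  assumes x: "x \<ge> 2" and ab: "a \<ge> 1" "b \<ge> 1" "a + b > 2" and strict: "x > 2 \<or> a + b > 4"
  shows "pv x (a + b) < pv x a * pv x b"
proof -
  consider "a = 1" "b \<ge> 2" | "b = 1" "a \<ge> 2" | "a \<ge> 2" "b \<ge> 2" using ab by linarith
  then have "defect x a b > 0"
  proof cases
    case 1
    then show ?thesis using defect_1_right[OF x 1(2)] strict by (auto simp: defect_commute[of x "Suc 0"])
  next
    case 2
    then show ?thesis using defect_1_right[OF x 2(2)] strict by auto
  next
    case 3
    then show ?thesis by (rule defect_pos[OF x])
  qed
  then show ?thesis by (simp add: defect_def)
qed

theorem theorem1p4:
  shows "(\<forall>(a::nat) (b::nat) (x::real). a \<ge> 1 \<and> b \<ge> 1 \<and> a + b > 2 \<and> x > 2 \<longrightarrow>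
            poly (P_poly a) x * poly (P_poly b) x > poly (P_poly (a + b)) x) \<and>
         (\<forall>(a::nat) (b::nat). a \<ge> 1 \<and> b \<ge> 1 \<and> a + b > 4 \<longrightarrow>
            poly (P_poly a) 2 * poly (P_poly b) 2 > poly (P_poly (a + b)) 2)"
proof (intro conjI allI impI)
  fix a b :: nat and x :: real
  assume "a \<ge> 1 \<and> b \<ge> 1 \<and> a + b > 2 \<and> x > 2"
  then show "poly (P_poly a) x * poly (P_poly b) x > poly (P_poly (a + b)) x"
    by (intro defect_pos_cases) simp_all
next
  fix a b :: nat
  assume "a \<ge> 1 \<and> b \<ge> 1 \<and> a + b > 4"
  then show "poly (P_poly a) 2 * poly (P_poly b) 2 > poly (P_poly (a + b)) 2"
    by (intro defect_pos_cases) simp_all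
qed

end
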